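(* The pole $\perp\!\!\!\perp$ is consistent: for every closed term $t$ there is a stack $\pi$ such that $t\ast\pi\notin\perp\!\!\!\perp$.
   Context: Fix pairwise disjoint countably infinite sets of $\lambda$-variables ($x,y,\dots$), stack variables ($\alpha,\beta,\dots$), term variables ($a,b,\dots$), and countable sets of labels $l$ and constructors $C$. Values, terms, stacks, processes: $v,w::=x\mid\lambda x\,t\mid C[v]\mid\{l_i=v_i\}_{i\in I}$; $t,u::=a\mid v\mid t\,u\mid\mu\alpha\,t\mid p\mid v.l\mid\mathrm{case}_v[C_i[x_i]\to t_i]_{i\in I}\mid\delta_{v,w}$; $\pi::=\alpha\mid v.\pi\mid[t]\pi$; $p::=t\ast\pi$; $I$ finite; $\lambda x$, $\mu\alpha$ and the $x_i$ in case branches are binders, term variables are never bound. A term is closed if it has no free variable of any kind. Substitutions map $\lambda$-variables to values, stack variables to stacks, term variables to terms (capture-avoiding). $\succ$ is the smallest relation on processes with: $t\,u\ast\pi\succ u\ast[t]\pi$; $v\ast[t]\pi\succ t\ast v.\pi$; $\lambda x\,t\ast v.\pi\succ t[x:=v]\ast\pi$; $\mu\alpha\,t\ast\pi\succ t[\alpha:=\pi]\ast\pi$; $p\ast\pi\succ p$; $\{l_i=v_i\}_{i\in I}.l_k\ast\pi\succ v_k\ast\pi$ ($k\in I$); $\mathrm{case}_{C_k[v]}[C_i[x_i]\to t_i]_{i\in I}\ast\pi\succ t_k[x_k:=v]\ast\pi$ ($k\in I$). A process is final if it is $v\ast\alpha$ with $v$ a value and $\alpha$ a stack variable; for a relation $R$,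 $p\Downarrow_R$ means $p\,R^*\,q$ with $q$ final. For $i\in\mathbb N$, inductively: $\rightsquigarrow_i=\succ\cup\{(\delta_{v,w}\ast\pi,v\ast\pi)\mid\exists j<i,\ v\not\equiv_jw\}$; $t\equiv_iu$ iff for all $j\le i$, stacks $\pi$, substitutions $\sigma$: $t\sigma\ast\pi\Downarrow_{\rightsquigarrow_j}\Leftrightarrow u\sigma\ast\pi\Downarrow_{\rightsquigarrow_j}$; $\not\equiv_i$ is its negation. $\rightsquigarrow=\bigcup_i\rightsquigarrow_i$. The pole is $\perp\!\!\!\perp=\{p\mid p\Downarrow_{\rightsquigarrow}\}$. *)

theory Defs
  imports Main "HOL-Library.Finite_Map" "HOL-Library.Countable"
begin

text \<open>
  Syntax, modulo renaming of bound variables: \<open>\<lambda>\<close>-variables and stack variables are de Bruijn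
  indices (two independent index spaces), and free variables are dangling indices. Term variables
  are never bound, so they are plain names. \<open>Lam\<close> and each branch of \<open>Case\<close> bind \<open>\<lambda>\<close>-index 0;
  \<open>Mu\<close> binds stack index 0. Finite families indexed by labels or constructors are finite maps,
  so their labels (constructors) are distinct and unordered.
\<close>

datatype ('l, 'c) val =
    LVar nat
  | Lam "('l, 'c) trm"
  | Con 'c "('l, 'c) val"
  | Rcd "('l, ('l, 'c) val) fmap"
and ('l, 'c) trm =
    TVar nat
  | Val "('l, 'c) val"
  | App "('l, 'c) trm" "('l, 'c) trm"
  | Mu "('l, 'c) trm"
  | Proc "('l, 'c) process"
  | Proj "('l, 'c) val" 'l
  | Case "('l, 'c) val" "('c, ('l, 'c) trm) fmap"
  | Delta "('l, 'c) val" "('l, 'c) val"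
and ('l, 'c) stack =
    SVar nat
  | PushV "('l, 'c) val" "('l, 'c) stack"
  | PushT "('l, 'c) trm" "('l, 'c) stack"
and ('l, 'c) process =
    Cut "('l, 'c) trm" "('l, 'c) stack" (infix \<open>\<star>\<close> 60)

datatype var = LV nat | SV nat | TV nat

text \<open>How a variable in the scope outside a binder is referred to inside that binder.\<close>

primrec under_lam :: "var \<Rightarrow> var" where
  "under_lam (LV n) = LV (Suc n)"
| "under_lam (SV n) = SV n"
| "under_lam (TV n) = TV n"

primrec under_mu :: "var \<Rightarrow> var" where
  "under_mu (LV n) = LV n"
| "under_mu (SV n) = SV (Suc n)"
| "under_mu (TV n) = TV n"

primrec fv_val :: "('l, 'c) val \<Rightarrow> var set"
  and fv_trm :: "('l, 'c) trm \<Rightarrow> var set"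
  and fv_stack :: "('l, 'c) stack \<Rightarrow> var set"
  and fv_process :: "('l, 'c) process \<Rightarrow> var set" where
  "fv_val (LVar n) = {LV n}"
| "fv_val (Lam t) = under_lam -` fv_trm t"
| "fv_val (Con c v) = fv_val v"
| "fv_val (Rcd m) = \<Union> (fmran' (fmmap fv_val m))"
| "fv_trm (TVar n) = {TV n}"
| "fv_trm (Val v) = fv_val v"
| "fv_trm (App t u) = fv_trm t \<union> fv_trm u"
| "fv_trm (Mu t) = under_mu -` fv_trm t"
| "fv_trm (Proc p) = fv_process p"
| "fv_trm (Proj v l) = fv_val v"
| "fv_trm (Case v bs) = fv_val v \<union> \<Union> (fmran' (fmmap (\<lambda>t. under_lam -` fv_trm t) bs))"
| "fv_trm (Delta v w) = fv_val v \<union> fv_val w"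
| "fv_stack (SVar n) = {SV n}"
| "fv_stack (PushV v \<pi>) = fv_val v \<union> fv_stack \<pi>"
| "fv_stack (PushT t \<pi>) = fv_trm t \<union> fv_stack \<pi>"
| "fv_process (t \<star> \<pi>) = fv_trm t \<union> fv_stack \<pi>"

definition closed_trm :: "('l, 'c) trm \<Rightarrow> bool" where
  "closed_trm t \<longleftrightarrow> fv_trm t = {}"

text \<open>
  Renaming of \<open>\<lambda>\<close>-indices by \<open>f\<close> and stack indices by \<open>g\<close>; only needed to move the range of a
  substitution under a binder.
\<close>

definition up_ren :: "(nat \<Rightarrow> nat) \<Rightarrow> nat \<Rightarrow> nat" where
  "up_ren f = case_nat 0 (\<lambda>n. Suc (f n))"

primrec ren_val :: "(nat \<Rightarrow> nat) \<Rightarrow> (nat \<Rightarrow> nat) \<Rightarrow> ('l, 'c) val \<Rightarrow> ('l, 'c) val"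
  and ren_trm :: "(nat \<Rightarrow> nat) \<Rightarrow> (nat \<Rightarrow> nat) \<Rightarrow> ('l, 'c) trm \<Rightarrow> ('l, 'c) trm"
  and ren_stack :: "(nat \<Rightarrow> nat) \<Rightarrow> (nat \<Rightarrow> nat) \<Rightarrow> ('l, 'c) stack \<Rightarrow> ('l, 'c) stack"
  and ren_process :: "(nat \<Rightarrow> nat) \<Rightarrow> (nat \<Rightarrow> nat) \<Rightarrow> ('l, 'c) process \<Rightarrow> ('l, 'c) process" where
  "ren_val f g (LVar n) = LVar (f n)"
| "ren_val f g (Lam t) = Lam (ren_trm (up_ren f) g t)"
| "ren_val f g (Con c v) = Con c (ren_val f g v)"
| "ren_val f g (Rcd m) = Rcd (fmmap (\<lambda>v. ren_val f g v) m)"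
| "ren_trm f g (TVar n) = TVar n"
| "ren_trm f g (Val v) = Val (ren_val f g v)"
| "ren_trm f g (App t u) = App (ren_trm f g t) (ren_trm f g u)"
| "ren_trm f g (Mu t) = Mu (ren_trm f (up_ren g) t)"
| "ren_trm f g (Proc p) = Proc (ren_process f g p)"
| "ren_trm f g (Proj v l) = Proj (ren_val f g v) l"
| "ren_trm f g (Case v bs) = Case (ren_val f g v) (fmmap (\<lambda>t. ren_trm (up_ren f) g t) bs)"
| "ren_trm f g (Delta v w) = Delta (ren_val f g v) (ren_val f g w)"
| "ren_stack f g (SVar n) = SVar (g n)"
| "ren_stack f g (PushV v \<pi>) = PushV (ren_val f g v) (ren_stack f g \<pi>)"
| "ren_stack f g (PushT t \<pi>) = PushT (ren_trm f g t) (ren_stack f g \<pi>)"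
| "ren_process f g (t \<star> \<pi>) = ren_trm f g t \<star> ren_stack f g \<pi>"

text \<open>
  A substitution acts simultaneously on the three kinds of variables; it is a triple of total
  functions, the identity being \<open>(LVar, SVar, TVar)\<close>.
\<close>

type_synonym ('l, 'c) subst =
  "(nat \<Rightarrow> ('l, 'c) val) \<times> (nat \<Rightarrow> ('l, 'c) stack) \<times> (nat \<Rightarrow> ('l, 'c) trm)"

definition up_lam :: "('l, 'c) subst \<Rightarrow> ('l, 'c) subst" where
  "up_lam = (\<lambda>(f, g, h).
    (case_nat (LVar 0) (\<lambda>n. ren_val Suc id (f n)),
     \<lambda>n. ren_stack Suc id (g n),
     \<lambda>n. ren_trm Suc id (h n)))"

definition up_mu :: "('l, 'c) subst \<Rightarrow> ('l, 'c) subst" where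
  "up_mu = (\<lambda>(f, g, h).
    (\<lambda>n. ren_val id Suc (f n),
     case_nat (SVar 0) (\<lambda>n. ren_stack id Suc (g n)),
     \<lambda>n. ren_trm id Suc (h n)))"

primrec subst_val :: "('l, 'c) subst \<Rightarrow> ('l, 'c) val \<Rightarrow> ('l, 'c) val"
  and subst_trm :: "('l, 'c) subst \<Rightarrow> ('l, 'c) trm \<Rightarrow> ('l, 'c) trm"
  and subst_stack :: "('l, 'c) subst \<Rightarrow> ('l, 'c) stack \<Rightarrow> ('l, 'c) stack"
  and subst_process :: "('l, 'c) subst \<Rightarrow> ('l, 'c) process \<Rightarrow> ('l, 'c) process" where
  "subst_val \<sigma> (LVar n) = fst \<sigma> n"
| "subst_val \<sigma> (Lam t) = Lam (subst_trm (up_lam \<sigma>) t)"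
| "subst_val \<sigma> (Con c v) = Con c (subst_val \<sigma> v)"
| "subst_val \<sigma> (Rcd m) = Rcd (fmmap (\<lambda>v. subst_val \<sigma> v) m)"
| "subst_trm \<sigma> (TVar n) = snd (snd \<sigma>) n"
| "subst_trm \<sigma> (Val v) = Val (subst_val \<sigma> v)"
| "subst_trm \<sigma> (App t u) = App (subst_trm \<sigma> t) (subst_trm \<sigma> u)"
| "subst_trm \<sigma> (Mu t) = Mu (subst_trm (up_mu \<sigma>) t)"
| "subst_trm \<sigma> (Proc p) = Proc (subst_process \<sigma> p)"
| "subst_trm \<sigma> (Proj v l) = Proj (subst_val \<sigma> v) l"
| "subst_trm \<sigma> (Case v bs) = Case (subst_val \<sigma> v) (fmmap (\<lambda>t. subst_trm (up_lam \<sigma>) t) bs)"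
| "subst_trm \<sigma> (Delta v w) = Delta (subst_val \<sigma> v) (subst_val \<sigma> w)"
| "subst_stack \<sigma> (SVar n) = fst (snd \<sigma>) n"
| "subst_stack \<sigma> (PushV v \<pi>) = PushV (subst_val \<sigma> v) (subst_stack \<sigma> \<pi>)"
| "subst_stack \<sigma> (PushT t \<pi>) = PushT (subst_trm \<sigma> t) (subst_stack \<sigma> \<pi>)"
| "subst_process \<sigma> (t \<star> \<pi>) = subst_trm \<sigma> t \<star> subst_stack \<sigma> \<pi>"

text \<open>Contraction of a binder: index 0 is replaced and the other indices move down by one.\<close>

definition inst_lam :: "('l, 'c) val \<Rightarrow> ('l, 'c) trm \<Rightarrow> ('l, 'c) trm" where
  "inst_lam v t = subst_trm (case_nat v LVar, SVar, TVar) t"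

definition inst_mu :: "('l, 'c) stack \<Rightarrow> ('l, 'c) trm \<Rightarrow> ('l, 'c) trm" where
  "inst_mu \<pi> t = subst_trm (LVar, case_nat \<pi> SVar, TVar) t"

inductive red :: "('l, 'c) process \<Rightarrow> ('l, 'c) process \<Rightarrow> bool" (infix \<open>\<succ>\<close> 50) where
  "App t u \<star> \<pi> \<succ> u \<star> PushT t \<pi>"
| "Val v \<star> PushT t \<pi> \<succ> t \<star> PushV v \<pi>"
| "Val (Lam t) \<star> PushV v \<pi> \<succ> inst_lam v t \<star> \<pi>"
| "Mu t \<star> \<pi> \<succ> inst_mu \<pi> t \<star> \<pi>"
| "Proc p \<star> \<pi> \<succ> p"
| "fmlookup m k = Some v \<Longrightarrow> Proj (Rcd m) k \<star> \<pi> \<succ> Val v \<star> \<pi>"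
| "fmlookup bs k = Some t \<Longrightarrow> Case (Con k v) bs \<star> \<pi> \<succ> inst_lam v t \<star> \<pi>"

definition final :: "('l, 'c) process \<Rightarrow> bool" where
  "final p \<longleftrightarrow> (\<exists>v \<alpha>. p = Val v \<star> SVar \<alpha>)"

definition converges ::
  "(('l, 'c) process \<Rightarrow> ('l, 'c) process \<Rightarrow> bool) \<Rightarrow> ('l, 'c) process \<Rightarrow> bool" where
  "converges R p \<longleftrightarrow> (\<exists>q. R\<^sup>*\<^sup>* p q \<and> final q)"

function red_at :: "nat \<Rightarrow> ('l, 'c) process \<Rightarrow> ('l, 'c) process \<Rightarrow> bool"
  and equiv_at :: "nat \<Rightarrow> ('l, 'c) trm \<Rightarrow> ('l, 'c) trm \<Rightarrow> bool" where
  "red_at i = (\<lambda>p q. p \<succ> q \<or>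
    (\<exists>v w \<pi>. p = Delta v w \<star> \<pi> \<and> q = Val v \<star> \<pi> \<and>
      (\<exists>j\<in>{..<i}. \<not> equiv_at j (Val v) (Val w))))"
| "equiv_at i = (\<lambda>t u. \<forall>j\<in>{..i}. \<forall>\<pi> \<sigma>.
    converges (red_at j) (subst_trm \<sigma> t \<star> \<pi>) \<longleftrightarrow> converges (red_at j) (subst_trm \<sigma> u \<star> \<pi>))"
  by pat_completeness auto
termination
  by (relation "measure (case_sum (\<lambda>i. 2 * i) (\<lambda>i. 2 * i + 1))") auto

text \<open>The equations for \<open>red_at\<close> and \<open>equiv_at\<close> loop as rewrite rules.\<close>

declare red_at.simps [simp del] equiv_at.simps [simp del]

definition red_delta :: "('l, 'c) process \<Rightarrow> ('l, 'c) process \<Rightarrow> bool" where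
  "red_delta p q \<longleftrightarrow> (\<exists>i. red_at i p q)"

definition pole :: "('l, 'c) process set" where
  "pole = {p. converges red_delta p}"

end

theory Submission
  imports Defs
begin

text \<open>
  Run \<open>t\<close> against the stack \<open>[{}]\<alpha>\<close>. As \<open>t\<close> is closed, throughout the execution every free stack
  variable sits directly below the frame \<open>[{}]\<close>, and it can only be uncovered in the process
  \<open>{} \<star> v.\<alpha>\<close>, which is stuck and not final. This holds even if \<open>\<delta>\<^bsub>v,w\<^esub> \<star> \<pi>\<close> is always
  allowed to reduce to \<open>v \<star> \<pi>\<close>, so nothing about the observational equivalences is needed.
\<close>

abbreviation empty_rcd :: "('l, 'c) trm" where
  "empty_rcd \<equiv> Val (Rcd fmempty)"

text \<open>Every stack variable not satisfying \<open>P\<close> occurs only in the form \<open>[{}]\<alpha>\<close>.\<close>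

primrec guarded_val :: "(nat \<Rightarrow> bool) \<Rightarrow> ('l, 'c) val \<Rightarrow> bool"
  and guarded_trm :: "(nat \<Rightarrow> bool) \<Rightarrow> ('l, 'c) trm \<Rightarrow> bool"
  and guarded_stack :: "(nat \<Rightarrow> bool) \<Rightarrow> ('l, 'c) stack \<Rightarrow> bool"
  and guarded_process :: "(nat \<Rightarrow> bool) \<Rightarrow> ('l, 'c) process \<Rightarrow> bool" where
  "guarded_val P (LVar n) \<longleftrightarrow> True"
| "guarded_val P (Lam t) \<longleftrightarrow> guarded_trm P t"
| "guarded_val P (Con c v) \<longleftrightarrow> guarded_val P v"
| "guarded_val P (Rcd m) \<longleftrightarrow> False \<notin> fmran' (fmmap (\<lambda>v. guarded_val P v) m)"
| "guarded_trm P (TVar n) \<longleftrightarrow> True"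
| "guarded_trm P (Val v) \<longleftrightarrow> guarded_val P v"
| "guarded_trm P (App t u) \<longleftrightarrow> guarded_trm P t \<and> guarded_trm P u"
| "guarded_trm P (Mu t) \<longleftrightarrow> guarded_trm (case_nat True P) t"
| "guarded_trm P (Proc p) \<longleftrightarrow> guarded_process P p"
| "guarded_trm P (Proj v l) \<longleftrightarrow> guarded_val P v"
| "guarded_trm P (Case v bs) \<longleftrightarrow>
     guarded_val P v \<and> False \<notin> fmran' (fmmap (\<lambda>t. guarded_trm P t) bs)"
| "guarded_trm P (Delta v w) \<longleftrightarrow> guarded_val P v \<and> guarded_val P w"
| "guarded_stack P (SVar n) \<longleftrightarrow> P n"
| "guarded_stack P (PushV v \<pi>) \<longleftrightarrow> guarded_val P v \<and> guarded_stack P \<pi>"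
| "guarded_stack P (PushT t \<pi>) \<longleftrightarrow>
     guarded_trm P t \<and> guarded_stack P \<pi> \<or> t = empty_rcd \<and> (\<exists>n. \<pi> = SVar n)"
| "guarded_process P (t \<star> \<pi>) \<longleftrightarrow> guarded_trm P t \<and> guarded_stack P \<pi>"

text \<open>Primitive recursion passes through a finite map by way of \<open>fmmap\<close>, hence
  the test against \<open>False\<close> in \<open>guarded_val\<close> and
  \<open>guarded_trm\<close>. This rule recovers the bounded quantifier.\<close>

lemma False_notin_fmran'_fmmap [simp]:
  "False \<notin> fmran' (fmmap f m) \<longleftrightarrow> (\<forall>x\<in>fmran' m. f x)"
  by (auto simp: fmran'_alt_def fmlookup_ran_iff)

text \<open>Only free stack variables can break guardedness. With \<open>P\<close> constantly false
  this turns closedness of a term into the initial invariant.\<close>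

lemma guarded_if_fv:
  fixes v :: "('l, 'c) val" and t :: "('l, 'c) trm"
    and \<pi> :: "('l, 'c) stack" and p :: "('l, 'c) process"
  shows "(\<And>n. SV n \<in> fv_val v \<Longrightarrow> P n) \<Longrightarrow> guarded_val P v"
    and "(\<And>n. SV n \<in> fv_trm t \<Longrightarrow> P n) \<Longrightarrow> guarded_trm P t"
    and "(\<And>n. SV n \<in> fv_stack \<pi> \<Longrightarrow> P n) \<Longrightarrow> guarded_stack P \<pi>"
    and "(\<And>n. SV n \<in> fv_process p \<Longrightarrow> P n) \<Longrightarrow> guarded_process P p"
proof (induction v and t and \<pi> and p arbitrary: P and P and P and P)
  case (Mu t)
  have "guarded_trm (case_nat True P) t"
    using Mu.prems by (intro Mu.IH) (auto split: nat.split)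
  then show ?case by simp
next
  case (Rcd m)
  have "guarded_val P v" if "v \<in> fmran' m" for v
    using Rcd.prems that by (intro Rcd.IH) (auto simp: fmap.set_map)
  then show ?case by simp
next
  case (Case v bs)
  have "guarded_trm P t" if "t \<in> fmran' bs" for t
    using that by (intro Case.IH Case.prems) (force simp: fmap.set_map)+
  with Case show ?case by simp
qed simp_all

text \<open>A renaming sends [{}]\<alpha> to some [{}]\<beta>, which is always allowed, so
  \<open>g\<close> is constrained only on the variables satisfying \<open>P\<close>.\<close>

lemma guarded_ren:
  fixes v :: "('l, 'c) val" and t :: "('l, 'c) trm"
    and \<pi> :: "('l, 'c) stack" and p :: "('l, 'c) process"
  shows "guarded_val P v \<Longrightarrow> (\<And>n. P n \<Longrightarrow> Q (g n)) \<Longrightarrow> guarded_val Q (ren_val f g v)"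
    and "guarded_trm P t \<Longrightarrow> (\<And>n. P n \<Longrightarrow> Q (g n)) \<Longrightarrow> guarded_trm Q (ren_trm f g t)"
    and "guarded_stack P \<pi> \<Longrightarrow> (\<And>n. P n \<Longrightarrow> Q (g n)) \<Longrightarrow> guarded_stack Q (ren_stack f g \<pi>)"
    and "guarded_process P p \<Longrightarrow> (\<And>n. P n \<Longrightarrow> Q (g n)) \<Longrightarrow> guarded_process Q (ren_process f g p)"
proof (induction v and t and \<pi> and p arbitrary: P Q f g and P Q f g and P Q f g and P Q f g)
  case (Mu t)
  show ?case
    using Mu.prems by (auto intro!: Mu.IH simp: up_ren_def split: nat.splits)
qed (auto simp: fmap.set_map)

lemma guarded_ren_lam:
  "guarded_val P v \<Longrightarrow> guarded_val P (ren_val f id v)"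
  "guarded_trm P t \<Longrightarrow> guarded_trm P (ren_trm f id t)"
  "guarded_stack P \<pi> \<Longrightarrow> guarded_stack P (ren_stack f id \<pi>)"
  by (auto intro: guarded_ren)

lemma guarded_ren_mu:
  "guarded_val P v \<Longrightarrow> guarded_val (case_nat True P) (ren_val f Suc v)"
  "guarded_trm P t \<Longrightarrow> guarded_trm (case_nat True P) (ren_trm f Suc t)"
  "guarded_stack P \<pi> \<Longrightarrow> guarded_stack (case_nat True P) (ren_stack f Suc \<pi>)"
  by (auto intro: guarded_ren)

text \<open>
  A stack variable not satisfying \<open>P\<close> must go to a variable: otherwise substituting in
  \<open>[{}]\<alpha>\<close> could put an arbitrary stack below the frame.
\<close>

definition guarded_subst :: "(nat \<Rightarrow> bool) \<Rightarrow> (nat \<Rightarrow> bool) \<Rightarrow> ('l, 'c) subst \<Rightarrow> bool" where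
  "guarded_subst P Q = (\<lambda>(f, g, h).
     (\<forall>n. guarded_val Q (f n)) \<and>
     (\<forall>n. if P n then guarded_stack Q (g n) else \<exists>m. g n = SVar m) \<and>
     (\<forall>n. guarded_trm Q (h n)))"

lemma guarded_subst_up_lam: "guarded_subst P Q \<sigma> \<Longrightarrow> guarded_subst P Q (up_lam \<sigma>)"
  by (cases \<sigma>)
    (fastforce simp: guarded_subst_def up_lam_def guarded_ren_lam split: nat.splits if_splits)

lemma guarded_subst_up_mu:
  "guarded_subst P Q \<sigma> \<Longrightarrow> guarded_subst (case_nat True P) (case_nat True Q) (up_mu \<sigma>)"
  by (cases \<sigma>)
    (fastforce simp: guarded_subst_def up_mu_def guarded_ren_mu split: nat.splits if_splits)

lemma guarded_subst:
  fixes v :: "('l, 'c) val" and t :: "('l, 'c) trm"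
    and \<pi> :: "('l, 'c) stack" and p :: "('l, 'c) process"
  shows "guarded_val P v \<Longrightarrow> guarded_subst P Q \<sigma> \<Longrightarrow> guarded_val Q (subst_val \<sigma> v)"
    and "guarded_trm P t \<Longrightarrow> guarded_subst P Q \<sigma> \<Longrightarrow> guarded_trm Q (subst_trm \<sigma> t)"
    and "guarded_stack P \<pi> \<Longrightarrow> guarded_subst P Q \<sigma> \<Longrightarrow> guarded_stack Q (subst_stack \<sigma> \<pi>)"
    and "guarded_process P p \<Longrightarrow> guarded_subst P Q \<sigma> \<Longrightarrow> guarded_process Q (subst_process \<sigma> p)"
proof (induction v and t and \<pi> and p arbitrary: P Q \<sigma> and P Q \<sigma> and P Q \<sigma> and P Q \<sigma>)
  case (PushT t \<pi>)
  from PushT.prems(1) consider "guarded_trm P t" "guarded_stack P \<pi>"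
    | n where "t = empty_rcd" "\<pi> = SVar n" by auto
  then show ?case
  proof cases
    case 1
    then show ?thesis using PushT by auto
  next
    case 2
    \<comment> \<open>The empty record is unchanged by \<sigma>. If \<open>P n\<close> holds, the
      image of \<open>n\<close> is guarded; otherwise it is a variable, again directly below the
      frame.\<close>
    then show ?thesis
      using PushT.prems(2) by (auto simp: guarded_subst_def split: prod.splits if_splits)
  qed
next
  case (LVar n)
  then show ?case by (simp add: guarded_subst_def case_prod_unfold)
next
  case (TVar n)
  then show ?case by (simp add: guarded_subst_def case_prod_unfold)
next
  case (SVar n)
  then show ?case by (simp add: guarded_subst_def case_prod_unfold)
next
  case (Case v bs)
  have "guarded_trm Q (subst_trm (up_lam \<sigma>) t)" if "t \<in> fmran' bs" for t
    using Case.prems that by (intro Case.IH(2)[of _ P]) (auto intro: guarded_subst_up_lam)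
  moreover have "guarded_val Q (subst_val \<sigma> v)"
    using Case.prems by (intro Case.IH(1)) auto
  ultimately show ?case by (simp add: fmap.set_map)
qed (auto simp: fmap.set_map guarded_subst_up_lam guarded_subst_up_mu)

lemma guarded_inst_lam:
  assumes "guarded_val (\<lambda>_. False) v" "guarded_trm (\<lambda>_. False) t"
  shows "guarded_trm (\<lambda>_. False) (inst_lam v t)"
  using assms unfolding inst_lam_def
  by (auto intro!: guarded_subst(2) simp: guarded_subst_def split: nat.split)

text \<open>Index 0, the only one satisfying the source predicate, goes to the guarded stack \<pi>;
  all others go to variables, as \<open>guarded_subst\<close> demands.\<close>

lemma guarded_inst_mu:
  assumes "guarded_stack (\<lambda>_. False) \<pi>" "guarded_trm (case_nat True (\<lambda>_. False)) t"
  shows "guarded_trm (\<lambda>_. False) (inst_mu \<pi> t)"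
  using assms(2) unfolding inst_mu_def
  by (rule guarded_subst(2)) (auto simp: assms(1) guarded_subst_def split: nat.split)

definition non_final :: "('l, 'c) process \<Rightarrow> bool" where
  "non_final p \<longleftrightarrow>
     guarded_process (\<lambda>_. False) p \<or> (\<exists>v n. p = empty_rcd \<star> PushV v (SVar n))"

lemma non_final_not_final: "non_final p \<Longrightarrow> \<not> final p"
  by (auto simp: non_final_def final_def)

text \<open>The only rule that can uncover a stack variable is the one popping the frame [{}], and
  it yields the second disjunct of \<open>non_final\<close>. That process has no successor, since
  the empty record is not an abstraction.\<close>

lemma non_final_red:
  assumes "p \<succ> q" "non_final p"
  shows "non_final q"
  using assms
  by cases (auto simp: non_final_def guarded_inst_lam guarded_inst_mu dest: fmran'I)

lemma non_final_red_delta: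
  assumes "red_delta p q" "non_final p"
  shows "non_final q"
  using assms
  \<comment> \<open>In a \<delta> step the stack is kept and the new head \<open>v\<close> is
    guarded as a component of \<open>Delta v w\<close>.\<close>
  by (auto simp: red_delta_def red_at.simps non_final_def
      dest: non_final_red[unfolded non_final_def])

lemma non_final_notin_pole:
  assumes "non_final p"
  shows "p \<notin> pole"
proof -
  have "non_final q" if "red_delta\<^sup>*\<^sup>* p q" for q
    using that assms by (induction rule: rtranclp_induct) (auto intro: non_final_red_delta)
  then show ?thesis
    by (auto simp: pole_def converges_def dest: non_final_not_final)
qed

theorem theorem5:
  fixes t :: "('l::countable, 'c::countable) trm"
  assumes "closed_trm t"
  shows "\<exists>\<pi>. t \<star> \<pi> \<notin> pole"
proof
  have "guarded_trm (\<lambda>_. False) t"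
    using assms by (intro guarded_if_fv) (simp add: closed_trm_def)
  \<comment> \<open>\<open>SVar 0\<close> violates the constantly false predicate, but the frame
    above it makes the stack guarded.\<close>
  then show "t \<star> PushT empty_rcd (SVar 0) \<notin> pole"
    by (intro non_final_notin_pole) (simp add: non_final_def)
qed

end
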